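(* Let $\alpha>0$. Assume MFCQ holds at all points of $\mathcal C$ and let $X\subset\mathbb R^n$ be an open set containing $\mathcal C$ on which $K_{\mathrm{cbf},\alpha}$ takes nonempty values. Let $x\in X$ and let $(u,v)$ be any solution of $\min_{(u,v)\in K_{\mathrm{cbf},\alpha}(x)}J(x,u,v)$. Then $\mathcal F(x,u,v)=\mathrm{proj}_{T^{(\alpha)}_{\mathcal C}(x)}(-F(x))$.
   Context: Setting: $F:\mathbb R^n\to\mathbb R^n$ and $g:\mathbb R^n\to\mathbb R^m$ are continuously differentiable, $h(x)=Hx-c_h$ with $H\in\mathbb R^{k\times n}$, $c_h\in\mathbb R^k$, and $\mathcal C=\{x\in\mathbb R^n\mid g(x)\le 0,\ h(x)=0\}$ is convex. The set of solutions of the variational inequality (points $x^*\in\mathcal C$ with $(x-x^* )^\top F(x^* )\ge 0$ for all $x\in\mathcal C$) is assumed nonempty. $\frac{\partial g(x)}{\partial x},\frac{\partial h(x)}{\partial x}$ denote Jacobians; $\mathrm{proj}$ is Euclidean projection. MFCQ at $x\in\mathcal C$: $\nabla h_1(x),\dots,\nabla h_k(x)$ are linearly independent and there is $\xi\in\mathbb R^n$ with $\nabla g_i(x)^\top\xi<0$ for all $i$ with $g_i(x)=0$ and $\nabla h_j(x)^\top\xi=0$ for all $j$. $\mathcal F(x,u,v)=-F(x)-\sum_{i=1}^m u_i\nabla g_i(x)-\sum_{j=1}^k v_j\nabla h_j(x)$. $K_{\mathrm{cbf},\alpha}(x)=\{(u,v)\in\mathbb R^m_{\ge0}\times\mathbb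 R^k\mid \frac{\partial g(x)}{\partial x}\mathcal F(x,u,v)\le-\alpha g(x),\ \frac{\partial h(x)}{\partial x}\mathcal F(x,u,v)=-\alpha h(x)\}$. $J(x,u,v)=\frac12\big\|\sum_{i=1}^m u_i\nabla g_i(x)+\sum_{j=1}^k v_j\nabla h_j(x)\big\|^2$. The $\alpha$-restricted tangent set is $T^{(\alpha)}_{\mathcal C}(x)=\{\xi\in\mathbb R^n\mid \frac{\partial g(x)}{\partial x}\xi\le-\alpha g(x),\ \frac{\partial h(x)}{\partial x}\xi=-\alpha h(x)\}$. *)

theory Defs
  imports "HOL-Analysis.Analysis"
begin

definition continuously_differentiable :: "(real^'n \<Rightarrow> real^'m) \<Rightarrow> bool" where
  "continuously_differentiable f \<longleftrightarrow>
     f differentiable_on UNIV \<and> continuous_on UNIV (\<lambda>x. jacobian f (at x))"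

(* Unspecified at points where f is not differentiable. *)
definition gradient :: "(real^'n \<Rightarrow> real) \<Rightarrow> real^'n \<Rightarrow> real^'n" where
  "gradient f x = (THE D. GDERIV f x :> D)"

lemma gradient_component_eq_row_jacobian:
  fixes f :: "real^'n \<Rightarrow> real^'m"
  assumes "f differentiable (at x)"
  shows "gradient (\<lambda>y. f y $ i) x = row i (jacobian f (at x))"
proof -
  have "(f has_derivative (\<lambda>d. jacobian f (at x) *v d)) (at x)"
    using assms jacobian_works by blast
  then have "((\<lambda>y. f y $ i) has_derivative (\<lambda>d. (jacobian f (at x) *v d) $ i)) (at x)"
    by (rule bounded_linear.has_derivative[OF bounded_linear_vec_nth])
  then have G: "GDERIV (\<lambda>y. f y $ i) x :> row i (jacobian f (at x))"
    by (simp add: gderiv_def matrix_vector_mul_component row_def inner_commute)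
  moreover have "D = row i (jacobian f (at x))" if "GDERIV (\<lambda>y. f y $ i) x :> D" for D
  proof -
    have "(\<lambda>d. d \<bullet> D) = (\<lambda>d. d \<bullet> row i (jacobian f (at x)))"
      using has_derivative_unique[OF that[unfolded gderiv_def] G[unfolded gderiv_def]] .
    then have "\<forall>d. d \<bullet> D = d \<bullet> row i (jacobian f (at x))"
      by (rule fun_cong[THEN allI])
    then show ?thesis
      by (simp only: vector_eq_ldot)
  qed
  ultimately show ?thesis
    unfolding gradient_def by (rule the_equality)
qed

(* The order on vectors is componentwise. *)
definition feasible_set :: "(real^'n \<Rightarrow> real^'m) \<Rightarrow> (real^'n \<Rightarrow> real^'k) \<Rightarrow> (real^'n) set" where
  "feasible_set g h = {x. g x \<le> 0 \<and> h x = 0}"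

definition VI_solutions :: "(real^'n \<Rightarrow> real^'n) \<Rightarrow> (real^'n) set \<Rightarrow> (real^'n) set" where
  "VI_solutions F C = {xs \<in> C. \<forall>x\<in>C. (x - xs) \<bullet> F xs \<ge> 0}"

(* Injectivity makes this independence of the family of gradients, not only of the set of
   its values. *)
definition MFCQ :: "(real^'n \<Rightarrow> real^'m) \<Rightarrow> (real^'n \<Rightarrow> real^'k) \<Rightarrow> real^'n \<Rightarrow> bool" where
  "MFCQ g h x \<longleftrightarrow>
     inj (\<lambda>j. gradient (\<lambda>y. h y $ j) x) \<and>
     independent (range (\<lambda>j. gradient (\<lambda>y. h y $ j) x)) \<and>
     (\<exists>\<xi>. (\<forall>i. g x $ i = 0 \<longrightarrow> gradient (\<lambda>y. g y $ i) x \<bullet> \<xi> < 0) \<and>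
          (\<forall>j. gradient (\<lambda>y. h y $ j) x \<bullet> \<xi> = 0))"

definition constraint_force ::
  "(real^'n \<Rightarrow> real^'m) \<Rightarrow> (real^'n \<Rightarrow> real^'k) \<Rightarrow> real^'n \<Rightarrow> real^'m \<Rightarrow> real^'k \<Rightarrow> real^'n" where
  "constraint_force g h x u v =
     (\<Sum>i\<in>UNIV. u $ i *\<^sub>R gradient (\<lambda>y. g y $ i) x) +
     (\<Sum>j\<in>UNIV. v $ j *\<^sub>R gradient (\<lambda>y. h y $ j) x)"

definition control_field ::
  "(real^'n \<Rightarrow> real^'n) \<Rightarrow> (real^'n \<Rightarrow> real^'m) \<Rightarrow> (real^'n \<Rightarrow> real^'k)
     \<Rightarrow> real^'n \<Rightarrow> real^'m \<Rightarrow> real^'k \<Rightarrow> real^'n" where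
  "control_field F g h x u v =
     - F x - (\<Sum>i\<in>UNIV. u $ i *\<^sub>R gradient (\<lambda>y. g y $ i) x)
           - (\<Sum>j\<in>UNIV. v $ j *\<^sub>R gradient (\<lambda>y. h y $ j) x)"

definition K_cbf ::
  "real \<Rightarrow> (real^'n \<Rightarrow> real^'n) \<Rightarrow> (real^'n \<Rightarrow> real^'m) \<Rightarrow> (real^'n \<Rightarrow> real^'k)
     \<Rightarrow> real^'n \<Rightarrow> ((real^'m) \<times> (real^'k)) set" where
  "K_cbf \<alpha> F g h x =
     {(u, v). 0 \<le> u \<and>
        jacobian g (at x) *v control_field F g h x u v \<le> - (\<alpha> *\<^sub>R g x) \<and>
        jacobian h (at x) *v control_field F g h x u v = - (\<alpha> *\<^sub>R h x)}"

definition J_cost ::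
  "(real^'n \<Rightarrow> real^'m) \<Rightarrow> (real^'n \<Rightarrow> real^'k) \<Rightarrow> real^'n \<Rightarrow> real^'m \<Rightarrow> real^'k \<Rightarrow> real" where
  "J_cost g h x u v = 1/2 * (norm (constraint_force g h x u v))\<^sup>2"

definition restricted_tangent_set ::
  "real \<Rightarrow> (real^'n \<Rightarrow> real^'m) \<Rightarrow> (real^'n \<Rightarrow> real^'k) \<Rightarrow> real^'n \<Rightarrow> (real^'n) set" where
  "restricted_tangent_set \<alpha> g h x =
     {\<xi>. jacobian g (at x) *v \<xi> \<le> - (\<alpha> *\<^sub>R g x) \<and>
         jacobian h (at x) *v \<xi> = - (\<alpha> *\<^sub>R h x)}"

end

theory Submission
  imports Defs
begin

text \<open>The image of \<^term>\<open>K_cbf \<alpha> F g h x\<close> under \<^const>\<open>control_field\<close> lies in the polyhedron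
  \<^term>\<open>restricted_tangent_set \<alpha> g h x\<close>, and the cost is half the squared distance of the image point
  to \<^term>\<open>- F x\<close>. By Farkas' lemma, the residual of the projection of \<^term>\<open>- F x\<close> onto that
  polyhedron is a combination of the constraint gradients with nonnegative weights on the
  inequalities, so the projection is itself such an image point. Any minimizer is therefore mapped
  to a nearest point, which is unique.\<close>

text \<open>A finitely generated convex cone is closed, so some hyperplane strictly separates
  \<open>y\<close> from it. Scaling inside the cone shows the separating functional \<open>e\<close>
  to be nonnegative there; \<open>d\<close> is \<open>- e\<close>.\<close>

lemma farkas_convex_cone_hull:
  fixes G :: "'a::euclidean_space set"
  assumes "finite G" and "y \<notin> convex_cone hull G"
  obtains d where "y \<bullet> d > 0" and "\<And>s. s \<in> G \<Longrightarrow> s \<bullet> d \<le> 0"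
proof -
  let ?K = "convex_cone hull G"
  obtain e \<beta> where e: "e \<bullet> y < \<beta>" "\<forall>z\<in>?K. e \<bullet> z > \<beta>"
    using separating_hyperplane_closed_point[of ?K y] assms
      convex_convex_cone_hull closed_convex_cone_hull by blast
  have "\<beta> < 0"
    using e(2) convex_cone_hull_contains_0[of G] by force
  have nonneg: "e \<bullet> s \<ge> 0" if "s \<in> ?K" for s
  proof (rule ccontr)
    assume "\<not> ?thesis"
    then have neg: "e \<bullet> s < 0" by simp
    \<comment> \<open>The factor is a quotient of two negative numbers, and it scales
      \<open>s\<close> to a point of the cone where \<open>e\<close> takes exactly the value
      \<beta>, against the strict bound.\<close>
    have "(\<beta> / (e \<bullet> s)) *\<^sub>R s \<in> ?K"
      using convex_cone_hull_mul[OF that] neg \<open>\<beta> < 0\<close> by (simp add: divide_nonpos_neg)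
    then have "e \<bullet> ((\<beta> / (e \<bullet> s)) *\<^sub>R s) > \<beta>"
      using e(2) by blast
    with neg show False by simp
  qed
  show thesis
  proof
    show "y \<bullet> (- e) > 0"
      using e(1) \<open>\<beta> < 0\<close> by (simp add: inner_commute)
    show "s \<bullet> (- e) \<le> 0" if "s \<in> G" for s
      using nonneg[OF hull_inc[OF that]] by (simp add: inner_commute)
  qed
qed

text \<open>These are the stationarity conditions for projecting onto a polyhedron: the residual
  lies in the normal cone at the nearest point, which is generated by the constraint
  normals.\<close>

lemma closest_point_polyhedron_residual:
  fixes a :: "'i::finite \<Rightarrow> 'a::euclidean_space" and c :: "'j::finite \<Rightarrow> 'a"
    and b :: "'i \<Rightarrow> real" and r :: "'j \<Rightarrow> real"
  defines "S \<equiv> {\<xi>. (\<forall>i. a i \<bullet> \<xi> \<le> b i) \<and> (\<forall>j. c j \<bullet> \<xi> = r j)}"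
  assumes "S \<noteq> {}"
  obtains u v where "\<And>i. 0 \<le> u i"
    and "y - closest_point S y = (\<Sum>i\<in>UNIV. u i *\<^sub>R a i) + (\<Sum>j\<in>UNIV. v j *\<^sub>R c j)"
proof -
  have S_Int: "S = (\<Inter>i. {\<xi>. a i \<bullet> \<xi> \<le> b i}) \<inter> (\<Inter>j. {\<xi>. c j \<bullet> \<xi> = r j})"
    by (auto simp: S_def)
  have "closed S"
    unfolding S_Int by (intro closed_Int closed_INT ballI closed_halfspace_le closed_hyperplane)
  have "convex S"
    unfolding S_Int by (intro convex_Int convex_INT convex_halfspace_le convex_hyperplane)
  define p where "p = closest_point S y"
  have "p \<in> S"
    unfolding p_def using \<open>closed S\<close> \<open>S \<noteq> {}\<close> by (rule closest_point_in_set)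
  then have p: "\<And>i. a i \<bullet> p \<le> b i" "\<And>j. c j \<bullet> p = r j"
    by (auto simp: S_def)
  \<comment> \<open>Only inequalities active at \<open>p\<close> contribute normals. Equality
    normals enter with both signs, which leaves their multipliers free in sign.\<close>
  define G where "G = a ` {i. a i \<bullet> p = b i} \<union> range c \<union> range (\<lambda>j. - c j)"
  have "finite G"
    by (simp add: G_def)
  \<comment> \<open>Otherwise the Farkas direction \<open>d\<close> is feasible at \<open>p\<close>
    and makes an acute angle with \<open>y - p\<close>, contradicting that \<open>p\<close> is
    nearest to \<open>y\<close>.\<close>
  have "y - p \<in> convex_cone hull G"
  proof (rule ccontr)
    assume "y - p \<notin> convex_cone hull G"
    then obtain d where d: "(y - p) \<bullet> d > 0" "\<And>s. s \<in> G \<Longrightarrow> s \<bullet> d \<le> 0"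
      using farkas_convex_cone_hull[OF \<open>finite G\<close>] by blast
    have d_eq: "c j \<bullet> d = 0" for j
      using d(2)[of "c j"] d(2)[of "- c j"] by (simp add: G_def)
    \<comment> \<open>Active constraints survive every positive step by the sign of
      \<open>a i \<bullet> d\<close>; slack ones survive small steps by continuity.\<close>
    have "\<forall>\<^sub>F t in at_right 0. a i \<bullet> (p + t *\<^sub>R d) \<le> b i" for i
    proof (cases "a i \<bullet> p = b i")
      case True
      then have "a i \<bullet> d \<le> 0"
        by (intro d(2)) (auto simp: G_def)
      then have "a i \<bullet> (p + t *\<^sub>R d) \<le> b i" if "t > 0" for t
        using that True by (simp add: inner_add_right mult_nonneg_nonpos)
      then show ?thesis
        by (intro eventually_at_right_less[THEN eventually_mono])
    next
      case False
      have "((\<lambda>t. a i \<bullet> (p + t *\<^sub>R d)) \<longlongrightarrow> a i \<bullet> (p + 0 *\<^sub>R d)) (at_right 0)"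
        by (intro tendsto_intros)
      then have "\<forall>\<^sub>F t in at_right 0. a i \<bullet> (p + t *\<^sub>R d) < b i"
        using False p(1)[of i] by (intro order_tendstoD(2)) auto
      then show ?thesis
        by (rule eventually_mono) simp
    qed
    then have "\<forall>\<^sub>F t in at_right 0. \<forall>i. a i \<bullet> (p + t *\<^sub>R d) \<le> b i"
      by (rule eventually_all_finite)
    then have "\<forall>\<^sub>F t in at_right (0::real). t > 0 \<and> (\<forall>i. a i \<bullet> (p + t *\<^sub>R d) \<le> b i)"
      using eventually_at_right_less by (rule eventually_conj[rotated])
    then obtain t :: real where t: "t > 0" "\<And>i. a i \<bullet> (p + t *\<^sub>R d) \<le> b i"
      using eventually_happens trivial_limit_at_right_real by blast
    then have "p + t *\<^sub>R d \<in> S"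
      by (simp add: S_def inner_add_right d_eq p)
    then have "(y - p) \<bullet> (p + t *\<^sub>R d - p) \<le> 0"
      unfolding p_def by (rule closest_point_dot[OF \<open>convex S\<close> \<open>closed S\<close>])
    with d(1) t(1) show False
      by (simp add: mult_le_0_iff)
  qed
  moreover
  \<comment> \<open>Membership in the hull becomes explicit weights by hull minimality: the vectors
    satisfying \<open>P\<close> form a convex cone containing \<open>G\<close>.\<close>
  define P where "P z \<longleftrightarrow> (\<exists>u v. (\<forall>i. 0 \<le> u i) \<and>
      z = (\<Sum>i\<in>UNIV. u i *\<^sub>R a i) + (\<Sum>j\<in>UNIV. v j *\<^sub>R c j))" for z
  have P_ineq: "P (a i)" for i
    unfolding P_def
    by (intro exI[of _ "\<lambda>i'. if i' = i then 1 else 0"] exI[of _ "\<lambda>_. 0"])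
      (simp add: if_distrib[of "\<lambda>s. s *\<^sub>R z" for z] cong: if_cong)
  \<comment> \<open>The free scalar covers three uses: 0 gives the zero vector, while 1 and -1 give
    the two signed copies of \<open>c j\<close> in \<open>G\<close>.\<close>
  have P_eq: "P (s *\<^sub>R c j)" for s j
    unfolding P_def
    by (intro exI[of _ "\<lambda>_. 0"] exI[of _ "\<lambda>j'. if j' = j then s else 0"])
      (simp add: if_distrib[of "\<lambda>s. s *\<^sub>R z" for z] cong: if_cong)
  have "convex_cone {z. P z}"
    unfolding convex_cone_iff
  proof (intro conjI ballI allI impI)
    show "0 \<in> {z. P z}"
      using P_eq[of 0] by simp
  next
    fix z w
    assume "z \<in> {z. P z}" "w \<in> {z. P z}"
    then obtain u v u' v' where "\<forall>i. 0 \<le> u i" "\<forall>i. 0 \<le> u' i"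
      "z = (\<Sum>i\<in>UNIV. u i *\<^sub>R a i) + (\<Sum>j\<in>UNIV. v j *\<^sub>R c j)"
      "w = (\<Sum>i\<in>UNIV. u' i *\<^sub>R a i) + (\<Sum>j\<in>UNIV. v' j *\<^sub>R c j)"
      by (auto simp: P_def)
    then show "z + w \<in> {z. P z}"
      unfolding P_def mem_Collect_eq
      by (intro exI[of _ "\<lambda>i. u i + u' i"] exI[of _ "\<lambda>j. v j + v' j"])
        (simp add: scaleR_add_left sum.distrib)
  next
    fix z and s :: real
    assume "z \<in> {z. P z}" "0 \<le> s"
    then obtain u v where "\<forall>i. 0 \<le> u i"
      "z = (\<Sum>i\<in>UNIV. u i *\<^sub>R a i) + (\<Sum>j\<in>UNIV. v j *\<^sub>R c j)"
      by (auto simp: P_def)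
    with \<open>0 \<le> s\<close> show "s *\<^sub>R z \<in> {z. P z}"
      unfolding P_def mem_Collect_eq
      by (intro exI[of _ "\<lambda>i. s * u i"] exI[of _ "\<lambda>j. s * v j"])
        (simp add: scaleR_add_right scaleR_sum_right)
  qed
  moreover have "G \<subseteq> {z. P z}"
    using P_ineq P_eq[of 1] P_eq[of "-1"] by (auto simp: G_def)
  ultimately have "P (y - p)"
    using hull_minimal[of G "{z. P z}" convex_cone] by blast
  then show thesis
    using that by (auto simp: P_def p_def)
qed

lemma control_field_eq: "control_field F g h x u v = - F x - constraint_force g h x u v"
  by (simp add: control_field_def constraint_force_def algebra_simps)

lemma mem_K_cbf_iff:
  "(u, v) \<in> K_cbf \<alpha> F g h x \<longleftrightarrow>
     0 \<le> u \<and> control_field F g h x u v \<in> restricted_tangent_set \<alpha> g h x"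
  by (simp add: K_cbf_def restricted_tangent_set_def)

text \<open>With gradients as normals, the residual of a projection onto this polyhedron takes the
  form of a \<open>constraint_force\<close>.\<close>

lemma restricted_tangent_set_eq_gradients:
  assumes "g differentiable (at x)" and "h differentiable (at x)"
  shows "restricted_tangent_set \<alpha> g h x =
    {\<xi>. (\<forall>i. gradient (\<lambda>y. g y $ i) x \<bullet> \<xi> \<le> - (\<alpha> * g x $ i)) \<and>
         (\<forall>j. gradient (\<lambda>y. h y $ j) x \<bullet> \<xi> = - (\<alpha> * h x $ j))}"
  by (simp add: restricted_tangent_set_def gradient_component_eq_row_jacobian[OF assms(1)]
      gradient_component_eq_row_jacobian[OF assms(2)] less_eq_vec_def vec_eq_iff
      matrix_vector_mul_component row_def)

lemma restricted_tangent_set_eq_Int: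
  "restricted_tangent_set \<alpha> g h x =
     (\<Inter>i. {\<xi>. jacobian g (at x) $ i \<bullet> \<xi> \<le> - (\<alpha> * g x $ i)}) \<inter>
     (\<Inter>j. {\<xi>. jacobian h (at x) $ j \<bullet> \<xi> = - (\<alpha> * h x $ j)})"
  by (auto simp: restricted_tangent_set_def less_eq_vec_def vec_eq_iff matrix_vector_mul_component)

lemma convex_restricted_tangent_set: "convex (restricted_tangent_set \<alpha> g h x)"
  unfolding restricted_tangent_set_eq_Int
  by (intro convex_Int convex_INT convex_halfspace_le convex_hyperplane)

lemma closed_restricted_tangent_set: "closed (restricted_tangent_set \<alpha> g h x)"
  unfolding restricted_tangent_set_eq_Int
  by (intro closed_Int closed_INT ballI closed_halfspace_le closed_hyperplane)

theorem proposition5p3: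
  fixes F :: "real^'n \<Rightarrow> real^'n"
    and g :: "real^'n \<Rightarrow> real^'m"
    and H :: "real^'n^'k" and c\<^sub>h :: "real^'k"
    and h :: "real^'n \<Rightarrow> real^'k"
    and \<alpha> :: real
    and X :: "(real^'n) set"
    and x :: "real^'n" and u :: "real^'m" and v :: "real^'k"
  assumes "continuously_differentiable F"
    and "continuously_differentiable g"
    and "h = (\<lambda>y. H *v y - c\<^sub>h)"
    and "convex (feasible_set g h)"
    and "VI_solutions F (feasible_set g h) \<noteq> {}"
    and "\<alpha> > 0"
    and "\<forall>y\<in>feasible_set g h. MFCQ g h y"
    and "open X"
    and "feasible_set g h \<subseteq> X"
    and "\<forall>y\<in>X. K_cbf \<alpha> F g h y \<noteq> {}"
    and "x \<in> X"
    and "is_arg_min (\<lambda>(u', v'). J_cost g h x u' v') (\<lambda>w. w \<in> K_cbf \<alpha> F g h x) (u, v)"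
  shows "control_field F g h x u v =
           closest_point (restricted_tangent_set \<alpha> g h x) (- F x)"
proof -
  let ?T = "restricted_tangent_set \<alpha> g h x"
  let ?p = "closest_point ?T (- F x)"
  have g: "g differentiable (at x)"
    using assms(2) by (simp add: continuously_differentiable_def differentiable_on_def)
  have h: "h differentiable (at x)"
    unfolding assms(3)
    by (intro differentiable_diff differentiable_const bounded_linear_imp_differentiable
        matrix_vector_mul_bounded_linear)
  have uv: "(u, v) \<in> K_cbf \<alpha> F g h x"
    and J_min: "\<And>u' v'. (u', v') \<in> K_cbf \<alpha> F g h x \<Longrightarrow> J_cost g h x u v \<le> J_cost g h x u' v'"
    using assms(12) by (auto simp: is_arg_min_linorder)
  have field_in: "control_field F g h x u v \<in> ?T"
    using uv by (simp add: mem_K_cbf_iff)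
  note T_eq = restricted_tangent_set_eq_gradients[OF g h, of \<alpha>]
  have "?T \<noteq> {}"
    using field_in by blast
  then obtain u0 v0 where u0: "\<And>i. 0 \<le> u0 i"
    and residual: "- F x - ?p = (\<Sum>i\<in>UNIV. u0 i *\<^sub>R gradient (\<lambda>y. g y $ i) x) +
      (\<Sum>j\<in>UNIV. v0 j *\<^sub>R gradient (\<lambda>y. h y $ j) x)"
    unfolding T_eq by (rule closest_point_polyhedron_residual[where y = "- F x"]) blast
  \<comment> \<open>The multipliers of the projection serve as a competitor to
    \<open>(u, v)\<close>: their force is the residual, so their control field is \<open>?p\<close>
    itself.\<close>
  let ?u = "\<chi> i. u0 i" and ?v = "\<chi> j. v0 j"
  have force: "constraint_force g h x ?u ?v = - F x - ?p"
    by (simp add: constraint_force_def residual)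
  have "?p \<in> ?T"
    using closest_point_in_set[OF closed_restricted_tangent_set] field_in by blast
  then have "(?u, ?v) \<in> K_cbf \<alpha> F g h x"
    by (simp add: mem_K_cbf_iff control_field_eq force less_eq_vec_def u0)
  then have "norm (constraint_force g h x u v) \<le> dist (- F x) ?p"
    using J_min by (force simp: J_cost_def force dist_norm)
  then have "dist (- F x) (control_field F g h x u v) \<le> dist (- F x) ?p"
    by (simp add: control_field_eq dist_norm)
  \<comment> \<open>In a closed convex set every point other than the nearest one is strictly
    farther away, so the bound forces equality.\<close>
  then show ?thesis
    using closest_point_lt[OF convex_restricted_tangent_set closed_restricted_tangent_set field_in]
    by fastforce
qed

end
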